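(* Let $E=(-1,1)^d$ and $F=(-1,1)^{d'}$. Let $\hat\pi_0$ be a Gaussian PSD model on $E$ of order $M_0$, $\hat Q(u,x)$ a Gaussian PSD model on $E\times E$ of order $M_Q$, and $\hat G(x,y)$ a Gaussian PSD model on $E\times F$ of order $M_G$. Let $(z_n)_{n\ge1}$ be a sequence in $F$ and let $(\hat\pi_n)_{n\ge 0}$ be the sequence of functions defined from $\hat\pi_0$ by $$\hat\pi_n=\frac{\hat R_n\hat\pi_{n-1}}{(\hat R_n\hat\pi_{n-1})(E)},\qquad (\hat R_n\mu)(x)=\int_E\hat Q(u,x)\,\hat G(x,z_n)\,\mu(u)\,du,\qquad (\hat R_n\mu)(E)=\int_E(\hat R_n\mu)(x)\,dx .$$ Then for every $n\ge1$, $\hat\pi_n$ is a Gaussian PSD model of order at most $M_Q\times M_G$, and it is computed by the PSD filter algorithm.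
   Context: A Gaussian PSD model of order $M$ on (a subset of) $\mathbb R^p$ is a function $f(x)=\sum_{i,j=1}^M A_{ij}k_\eta(x,x_i)k_\eta(x,x_j)$, where $\eta\in\mathbb R^p$ has positive entries, $x_1,\dots,x_M\in\mathbb R^p$ are anchor points, $A\in\mathbb R^{M\times M}$ is symmetric positive semidefinite and $k_\eta(x,y)=\exp(-\sum_{l}\eta_l(x_l-y_l)^2)$. On a product space the precision vector is the concatenation of the precision vectors of the factors. Normalizing constants are assumed nonzero so that the recursion is well defined. PSD filter algorithm: for $k=1,\dots,T$, form the product $\hat\pi_{k-1}(u)\hat Q(u,x)$; marginalize over $u\in E$ to obtain $x\mapsto\int_E\hat Q(u,x)\hat\pi_{k-1}(u)du$; partially evaluate $\hat G_k(x)=\hat G(x,z_k)$; form the product $\tilde\pi_k$ of these two functions; compute $Z=\int_E\tilde\pi_k$; set $\hat\pi_k=\tilde\pi_k/Z$. Each of these operations (product, marginalization, partial evaluation, integral) is computed exactly in closed form on the parameters of the models. *)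

theory Defs
  imports "HOL-Analysis.Analysis"
begin

text \<open>
  A model lives on a Euclidean space. On a product \<open>'a \<times> 'b\<close> the basis is the disjoint union of the
  two bases, so a precision vector \<open>(\<eta>, \<theta>)\<close> is the concatenation of the precisions of the factors.
\<close>

definition gkernel :: "'a::euclidean_space \<Rightarrow> 'a \<Rightarrow> 'a \<Rightarrow> real" where
  "gkernel \<eta> x y = exp (- (\<Sum>b\<in>Basis. (\<eta> \<bullet> b) * ((x - y) \<bullet> b)\<^sup>2))"

text \<open>The \<open>M \<times> M\<close> matrices are functions of which only the entries with both indices below \<open>M\<close> matter.\<close>

definition psd_matrix :: "nat \<Rightarrow> (nat \<Rightarrow> nat \<Rightarrow> real) \<Rightarrow> bool" where
  "psd_matrix M A \<longleftrightarrow>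
     (\<forall>i<M. \<forall>j<M. A i j = A j i) \<and>
     (\<forall>v. 0 \<le> (\<Sum>i<M. \<Sum>j<M. v i * A i j * v j))"

datatype 'a psd_params =
  PSD_Params (anchors: "'a list") (precision: 'a) (coeffs: "nat \<Rightarrow> nat \<Rightarrow> real")

definition psd_order :: "'a psd_params \<Rightarrow> nat" where
  "psd_order P = length (anchors P)"

definition valid_params :: "'a::euclidean_space psd_params \<Rightarrow> bool" where
  "valid_params P \<longleftrightarrow>
     (\<forall>b\<in>Basis. 0 < precision P \<bullet> b) \<and> psd_matrix (psd_order P) (coeffs P)"

definition psd_eval :: "'a::euclidean_space psd_params \<Rightarrow> 'a \<Rightarrow> real" where
  "psd_eval P x = (\<Sum>i<psd_order P. \<Sum>j<psd_order P.
     coeffs P i j * gkernel (precision P) x (anchors P ! i) * gkernel (precision P) x (anchors P ! j))"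

definition represents_on :: "'a::euclidean_space set \<Rightarrow> 'a psd_params \<Rightarrow> ('a \<Rightarrow> real) \<Rightarrow> bool" where
  "represents_on S P f \<longleftrightarrow> valid_params P \<and> (\<forall>x\<in>S. f x = psd_eval P x)"

definition gaussian_psd_model_on :: "'a::euclidean_space set \<Rightarrow> nat \<Rightarrow> ('a \<Rightarrow> real) \<Rightarrow> bool" where
  "gaussian_psd_model_on S M f \<longleftrightarrow> (\<exists>P. psd_order P = M \<and> represents_on S P f)"

text \<open>The open cube \<open>(-1,1)\<^sup>d\<close>.\<close>

definition cube :: "'a::euclidean_space set" where
  "cube = {x. \<forall>b\<in>Basis. -1 < x \<bullet> b \<and> x \<bullet> b < 1}"

definition filter_op ::
  "('a::euclidean_space \<times> 'a \<Rightarrow> real) \<Rightarrow> ('a \<times> 'b \<Rightarrow> real) \<Rightarrow> 'b \<Rightarrow> ('a \<Rightarrow> real) \<Rightarrow> 'a \<Rightarrow> real"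
where
  "filter_op Q G z \<mu> x = (LINT u:cube|lborel. Q (u, x) * G (x, z) * \<mu> u)"

definition filter_mass ::
  "('a::euclidean_space \<times> 'a \<Rightarrow> real) \<Rightarrow> ('a \<times> 'b \<Rightarrow> real) \<Rightarrow> 'b \<Rightarrow> ('a \<Rightarrow> real) \<Rightarrow> real"
where
  "filter_mass Q G z \<mu> = (LINT x:cube|lborel. filter_op Q G z \<mu> x)"


subsection \<open>Closed-form operations on parameters\<close>

text \<open>
  Products rest on the identity
  \<open>gkernel \<eta> x a * gkernel \<theta> x b =
    overlap \<eta> a \<theta> b * gkernel (\<eta> + \<theta>) x (weighted_mean \<eta> a \<theta> b)\<close>.
\<close>

definition weighted_mean :: "'a::euclidean_space \<Rightarrow> 'a \<Rightarrow> 'a \<Rightarrow> 'a \<Rightarrow> 'a" where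
  "weighted_mean \<eta> a \<theta> b =
     (\<Sum>e\<in>Basis. (((\<eta> \<bullet> e) * (a \<bullet> e) + (\<theta> \<bullet> e) * (b \<bullet> e)) / (\<eta> \<bullet> e + \<theta> \<bullet> e)) *\<^sub>R e)"

definition overlap :: "'a::euclidean_space \<Rightarrow> 'a \<Rightarrow> 'a \<Rightarrow> 'a \<Rightarrow> real" where
  "overlap \<eta> a \<theta> b =
     exp (- (\<Sum>e\<in>Basis. (\<eta> \<bullet> e) * (\<theta> \<bullet> e) / (\<eta> \<bullet> e + \<theta> \<bullet> e) * ((a - b) \<bullet> e)\<^sup>2))"

text \<open>
  Kronecker product with right factor of size \<open>m\<close>; its indexing agrees with that of
  \<^const>\<open>List.product\<close> when the second list has length \<open>m\<close>.
\<close>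

definition kron ::
  "nat \<Rightarrow> (nat \<Rightarrow> nat \<Rightarrow> real) \<Rightarrow> (nat \<Rightarrow> nat \<Rightarrow> real) \<Rightarrow> nat \<Rightarrow> nat \<Rightarrow> real"
where
  "kron m A B i j = A (i div m) (j div m) * B (i mod m) (j mod m)"

text \<open>Parameters of \<open>x \<mapsto> f x * g x\<close>.\<close>

definition psd_mult ::
  "'a::euclidean_space psd_params \<Rightarrow> 'a psd_params \<Rightarrow> 'a psd_params"
where
  "psd_mult P Q =
     (let pairs = List.product (anchors P) (anchors Q);
          w = (\<lambda>i. case pairs ! i of (a, b) \<Rightarrow> overlap (precision P) a (precision Q) b)
      in PSD_Params
           (map (\<lambda>(a, b). weighted_mean (precision P) a (precision Q) b) pairs)
           (precision P + precision Q)
           (\<lambda>i j. kron (psd_order Q) (coeffs P) (coeffs Q) i j * w i * w j))"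

text \<open>Parameters of \<open>(u, x) \<mapsto> f u * g (u, x)\<close>.\<close>

definition psd_mult_fst ::
  "'a::euclidean_space psd_params \<Rightarrow> ('a \<times> 'b::euclidean_space) psd_params \<Rightarrow> ('a \<times> 'b) psd_params"
where
  "psd_mult_fst P Q =
     (let pairs = List.product (anchors P) (anchors Q);
          \<eta> = precision P; \<theta> = fst (precision Q);
          w = (\<lambda>i. case pairs ! i of (a, b) \<Rightarrow> overlap \<eta> a \<theta> (fst b))
      in PSD_Params
           (map (\<lambda>(a, b). (weighted_mean \<eta> a \<theta> (fst b), snd b)) pairs)
           (\<eta> + \<theta>, snd (precision Q))
           (\<lambda>i j. kron (psd_order Q) (coeffs P) (coeffs Q) i j * w i * w j))"

text \<open>Parameters of \<open>x \<mapsto> g (x, z)\<close>.\<close>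

definition psd_partial_eval ::
  "('a::euclidean_space \<times> 'b::euclidean_space) psd_params \<Rightarrow> 'b \<Rightarrow> 'a psd_params"
where
  "psd_partial_eval G z =
     (let w = (\<lambda>i. gkernel (snd (precision G)) z (snd (anchors G ! i)))
      in PSD_Params (map fst (anchors G)) (fst (precision G)) (\<lambda>i j. coeffs G i j * w i * w j))"

definition erf :: "real \<Rightarrow> real" where
  "erf x = 2 / sqrt pi * (LBINT t=0..x. exp (- t\<^sup>2))"

text \<open>
  \<open>cube_gram \<eta> a b\<close> is the closed form of \<open>LINT u:cube|lborel. gkernel \<eta> u a * gkernel \<eta> u b\<close>: the
  integrand is \<open>gkernel (\<eta> / 2) a b * gkernel (2 * \<eta>) u ((a + b) / 2)\<close>, and the integral of the latter
  kernel factors over the coordinates.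
\<close>

definition cube_gauss :: "'a::euclidean_space \<Rightarrow> 'a \<Rightarrow> real" where
  "cube_gauss \<eta> c = (\<Prod>b\<in>Basis. sqrt pi / (2 * sqrt (\<eta> \<bullet> b)) *
     (erf (sqrt (\<eta> \<bullet> b) * (1 - c \<bullet> b)) + erf (sqrt (\<eta> \<bullet> b) * (1 + c \<bullet> b))))"

definition cube_gram :: "'a::euclidean_space \<Rightarrow> 'a \<Rightarrow> 'a \<Rightarrow> real" where
  "cube_gram \<eta> a b = gkernel ((1 / 2) *\<^sub>R \<eta>) a b * cube_gauss (2 *\<^sub>R \<eta>) ((1 / 2) *\<^sub>R (a + b))"

text \<open>
  Collecting the terms with equal anchor points leaves the function unchanged. After marginalizing
  \<open>(u, x) \<mapsto> f u * g (u, x)\<close> over \<open>u\<close> this is what keeps the order bounded by the order of \<open>g\<close>, since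
  the remaining anchor points are the \<open>x\<close>-components of those of \<open>g\<close>, each of them repeated.
\<close>

definition psd_collect :: "'a psd_params \<Rightarrow> 'a psd_params" where
  "psd_collect P =
     (let xs = remdups (anchors P);
          cls = (\<lambda>p. {i. i < psd_order P \<and> anchors P ! i = xs ! p})
      in PSD_Params xs (precision P) (\<lambda>p q. \<Sum>i\<in>cls p. \<Sum>j\<in>cls q. coeffs P i j))"

text \<open>Parameters of \<open>x \<mapsto> LINT u:cube|lborel. f (u, x)\<close>.\<close>

definition psd_marginal ::
  "('a::euclidean_space \<times> 'b::euclidean_space) psd_params \<Rightarrow> 'b psd_params"
where
  "psd_marginal P = psd_collect (PSD_Params (map snd (anchors P)) (snd (precision P))
     (\<lambda>i j. coeffs P i j * cube_gram (fst (precision P)) (fst (anchors P ! i)) (fst (anchors P ! j))))"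

text \<open>Closed form of \<open>LINT x:cube|lborel. f x\<close>.\<close>

definition psd_integral :: "'a::euclidean_space psd_params \<Rightarrow> real" where
  "psd_integral P = (\<Sum>i<psd_order P. \<Sum>j<psd_order P.
     coeffs P i j * cube_gram (precision P) (anchors P ! i) (anchors P ! j))"

definition psd_scale :: "real \<Rightarrow> 'a psd_params \<Rightarrow> 'a psd_params" where
  "psd_scale c P = PSD_Params (anchors P) (precision P) (\<lambda>i j. c * coeffs P i j)"


subsection \<open>The PSD filter\<close>

definition psd_predict ::
  "('a::euclidean_space \<times> 'a) psd_params \<Rightarrow> 'a psd_params \<Rightarrow> 'a psd_params"
where
  "psd_predict PQ P = psd_marginal (psd_mult_fst P PQ)"

definition psd_update ::
  "('a::euclidean_space \<times> 'a) psd_params \<Rightarrow> ('a \<times> 'b::euclidean_space) psd_params \<Rightarrow> 'b \<Rightarrow>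
   'a psd_params \<Rightarrow> 'a psd_params"
where
  "psd_update PQ PG z P = psd_mult (psd_predict PQ P) (psd_partial_eval PG z)"

primrec psd_filter ::
  "'a::euclidean_space psd_params \<Rightarrow> ('a \<times> 'a) psd_params \<Rightarrow> ('a \<times> 'b::euclidean_space) psd_params \<Rightarrow>
   (nat \<Rightarrow> 'b) \<Rightarrow> nat \<Rightarrow> 'a psd_params"
where
  "psd_filter P0 PQ PG z 0 = P0"
| "psd_filter P0 PQ PG z (Suc k) =
     (let T = psd_update PQ PG (z (Suc k)) (psd_filter P0 PQ PG z k)
      in psd_scale (1 / psd_integral T) T)"

end

theory Submission
  imports Defs
begin

text \<open>
  Marginalization multiplies the coefficients entrywise by the Gram matrix of the kernels in
  \<open>L\<^sup>2(cube)\<close>, which preserves positive semidefiniteness because the resulting quadratic form is the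
  integral of the original one. Gaussian multiplication turns products of models into Kronecker
  products of coefficient matrices. After prediction only the \<open>x\<close>-anchors of the transition model
  survive, so the order does not grow with \<open>n\<close>. The normalizing constant is nonnegative as the
  integral of a model, so rescaling by its inverse keeps the coefficients positive semidefinite.
\<close>

subsection \<open>Positive semidefinite matrices\<close>

lemma psd_matrixD:
  assumes "psd_matrix n A"
  shows "0 \<le> (\<Sum>i<n. \<Sum>j<n. v i * A i j * v j)" and "i < n \<Longrightarrow> j < n \<Longrightarrow> A i j = A j i"
  using assms by (auto simp: psd_matrix_def)

text \<open>Symmetry merges the last row and the last column into one mixed term, which is linear in
  the last coordinate. This is the expansion behind the induction on the size of the matrix.\<close>

lemma quadratic_form_Suc:
  fixes A :: "nat \<Rightarrow> nat \<Rightarrow> real"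
  assumes "\<And>i j. i < Suc n \<Longrightarrow> j < Suc n \<Longrightarrow> A i j = A j i"
  shows "(\<Sum>i<Suc n. \<Sum>j<Suc n. v i * A i j * v j) =
    (\<Sum>i<n. \<Sum>j<n. v i * A i j * v j) + 2 * v n * (\<Sum>i<n. v i * A i n) + (v n)\<^sup>2 * A n n"
proof -
  have "(\<Sum>j<n. v n * A n j * v j) = v n * (\<Sum>i<n. v i * A i n)"
    unfolding sum_distrib_left using assms by (intro sum.cong) auto
  moreover have "(\<Sum>i<n. v i * A i n * v n) = v n * (\<Sum>i<n. v i * A i n)"
    unfolding sum_distrib_left by (intro sum.cong) auto
  ultimately show ?thesis
    by (simp add: sum.distrib power2_eq_square)
qed

text \<open>An affine function of \<open>c\<close> that is bounded below on the whole line has slope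
  zero; the chosen \<open>c\<close> would give the value -1.\<close>

lemma linear_nonneg_imp_zero:
  fixes a b :: real
  assumes "\<And>c. 0 \<le> a + 2 * c * b"
  shows "b = 0"
proof (rule ccontr)
  assume "b \<noteq> 0"
  then show False using assms[of "- (a + 1) / (2 * b)"] by (simp add: field_simps)
qed

text \<open>The last unit vector shows the sign of the corner. If the corner vanishes, the form at
  the \<open>i\<close>-th unit vector plus \<open>c\<close> times the last one is
  \<open>A i i + 2 * c * A i n\<close>, affine in \<open>c\<close>, so the mixed entry must
  vanish.\<close>

lemma psd_matrix_last:
  assumes "psd_matrix (Suc n) A"
  shows "0 \<le> A n n" and "A n n = 0 \<Longrightarrow> i < n \<Longrightarrow> A i n = 0"
proof -
  have form: "0 \<le> (\<Sum>i<n. \<Sum>j<n. v i * A i j * v j) + 2 * v n * (\<Sum>i<n. v i * A i n) + (v n)\<^sup>2 * A n n"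
    for v
    using psd_matrixD(1)[OF assms, of v] psd_matrixD(2)[OF assms] quadratic_form_Suc[of n A v] by simp
  show "0 \<le> A n n" using form[of "\<lambda>i. if i = n then 1 else 0"] by simp
  assume "A n n = 0" "i < n"
  have "0 \<le> A i i + 2 * c * A i n" for c
  proof -
    define v where "v = (\<lambda>k. if k = n then c else if k = i then 1 else (0::real))"
    have "(\<Sum>k<n. v k * f k) = f i" for f :: "nat \<Rightarrow> real"
    proof -
      have "(\<Sum>k<n. v k * f k) = (\<Sum>k<n. if k = i then f k else 0)"
        by (intro sum.cong) (auto simp: v_def)
      then show ?thesis using \<open>i < n\<close> by simp
    qed
    note pick = this
    have "(\<Sum>k<n. \<Sum>l<n. v k * A k l * v l) = (\<Sum>k<n. v k * (\<Sum>l<n. v l * A k l))"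
      by (simp add: sum_distrib_left mult_ac)
    moreover have "v n = c" by (simp add: v_def)
    ultimately show ?thesis using form[of v] \<open>A n n = 0\<close> by (simp add: pick)
  qed
  then show "A i n = 0" by (rule linear_nonneg_imp_zero)
qed

text \<open>
  Cholesky factorization: the Schur complement of the last diagonal entry is again positive
  semidefinite. When that entry is \<open>0\<close> its column vanishes, and \<open>x / 0 = 0\<close> makes the formulas valid.
\<close>

lemma psd_matrix_gram:
  assumes "psd_matrix n A"
  shows "\<exists>W. \<forall>i<n. \<forall>j<n. A i j = (\<Sum>k<n. W k i * W k j)"
  using assms
proof (induction n arbitrary: A)
  case 0
  then show ?case by simp
next
  case (Suc n)
  define B where "B i j = A i j - A i n * A j n / A n n" for i j
  note sym = psd_matrixD(2)[OF Suc.prems] and last = psd_matrix_last[OF Suc.prems]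
  have "psd_matrix n B"
    unfolding psd_matrix_def
  proof (intro conjI allI impI)
    show "B i j = B j i" if "i < n" "j < n" for i j
      using sym[of i j] that by (simp add: B_def mult.commute)
    fix v
    define s where "s = (\<Sum>i<n. v i * A i n)"
    \<comment> \<open>This last coordinate completes the square: for a positive corner it minimizes
      the form of \<open>A\<close> over all extensions of \<open>v\<close>, and the minimum is the
      form of the Schur complement \<open>B\<close> at \<open>v\<close>.\<close>
    define w where "w = v(n := - s / A n n)"
    have w: "w i = v i" if "i < n" for i using that by (simp add: w_def)
    have "(\<Sum>i<n. \<Sum>j<n. v i * B i j * v j) =
      (\<Sum>i<n. \<Sum>j<n. v i * A i j * v j) - (\<Sum>i<n. \<Sum>j<n. (v i * A i n) * (v j * A j n) / A n n)"
      by (simp add: B_def algebra_simps sum_subtractf)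
    also have "(\<Sum>i<n. \<Sum>j<n. (v i * A i n) * (v j * A j n) / A n n) = s * s / A n n"
      by (simp add: s_def sum_product sum_divide_distrib)
    also have "(\<Sum>i<n. \<Sum>j<n. v i * A i j * v j) - s * s / A n n =
        (\<Sum>i<Suc n. \<Sum>j<Suc n. w i * A i j * w j)"
      using sym by (subst quadratic_form_Suc)
        (auto simp: w s_def[symmetric] w_def power2_eq_square divide_simps)
    also have "\<dots> \<ge> 0" by (rule psd_matrixD(1)[OF Suc.prems])
    finally show "0 \<le> (\<Sum>i<n. \<Sum>j<n. v i * B i j * v j)" .
  qed
  from Suc.IH[OF this] obtain W where
    W: "\<And>i j. i < n \<Longrightarrow> j < n \<Longrightarrow> B i j = (\<Sum>k<n. W k i * W k j)" by blast
  \<comment> \<open>The new row is the last column of \<open>A\<close> divided by the root of the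
    corner, so that it contributes exactly the term subtracted in \<open>B\<close>; the old rows are
    padded with zero at index \<open>n\<close>.\<close>
  define V where "V k i = (if k = n then A i n / sqrt (A n n) else if i = n then 0 else W k i)" for k i
  have "A i j = (\<Sum>k<Suc n. V k i * V k j)" if "i < Suc n" "j < Suc n" for i j
  proof -
    have Vn: "V n i * V n j = A i n * A j n / A n n"
      using last(1) by (simp add: V_def)
    have col: "A n n = 0 \<Longrightarrow> A i n = 0" "A n n = 0 \<Longrightarrow> A j n = 0"
      using last(2) that by (auto simp: less_Suc_eq)
    show ?thesis
    proof (cases "i < n \<and> j < n")
      case True
      then have "(\<Sum>k<n. V k i * V k j) = B i j"
        unfolding W[OF conjunct1[OF True] conjunct2[OF True]] by (intro sum.cong) (auto simp: V_def)
      then show ?thesis by (simp add: Vn B_def)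
    next
      case False
      then have "i = n \<or> j = n" using that by auto
      then have "(\<Sum>k<n. V k i * V k j) = 0" by (intro sum.neutral) (auto simp: V_def)
      moreover have "A i j = A i n * A j n / A n n"
        using \<open>i = n \<or> j = n\<close> col sym[of i n] sym[of n j] that by (cases "A n n = 0") auto
      ultimately show ?thesis by (simp add: Vn)
    qed
  qed
  then show ?case by blast
qed

text \<open>Congruence by a diagonal matrix: the weights move into the test vector. It covers the
  overlap weights of products and the kernel values of partial evaluation.\<close>

lemma psd_matrix_congruence:
  assumes "psd_matrix n A" shows "psd_matrix n (\<lambda>i j. A i j * w i * w j)"
  unfolding psd_matrix_def
proof (intro conjI allI impI)
  show "A i j * w i * w j = A j i * w j * w i" if "i < n" "j < n" for i j
    using psd_matrixD(2)[OF assms that] by simp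
  show "0 \<le> (\<Sum>i<n. \<Sum>j<n. v i * (A i j * w i * w j) * v j)" for v
    using psd_matrixD(1)[OF assms, of "\<lambda>i. v i * w i"] by (simp add: mult_ac)
qed

lemma psd_matrix_scale:
  assumes "psd_matrix n A" "0 \<le> c" shows "psd_matrix n (\<lambda>i j. c * A i j)"
proof -
  have "A i j * sqrt c * sqrt c = c * A i j" for i j
    using assms(2) by (simp add: mult.assoc)
  then show ?thesis using psd_matrix_congruence[OF assms(1), of "\<lambda>_. sqrt c"] by (simp only:)
qed

section \<open>Kronecker products of coefficient matrices\<close>

lemma div_mod_less:
  fixes i m n :: nat
  assumes "i < m * n" shows "i div n < m" "i mod n < n"
proof -
  have "n > 0" using assms by (cases n) auto
  then show "i div n < m" "i mod n < n" using assms by (simp_all add: less_mult_imp_div_less)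
qed

text \<open>Exchanges of adjacent sums bring the index \<open>k\<close> of the Gram factorization
  outermost and the indices \<open>p\<close>, \<open>q\<close> of the right matrix next to it,
  leaving the two contractions over \<open>i\<close> and \<open>j\<close> innermost.\<close>

lemma sum_rearrange5:
  fixes f :: "nat \<Rightarrow> nat \<Rightarrow> nat \<Rightarrow> nat \<Rightarrow> nat \<Rightarrow> real"
  shows "(\<Sum>i<m. \<Sum>p<n. \<Sum>j<m. \<Sum>q<n. \<Sum>k<m. f i p j q k) =
    (\<Sum>k<m. \<Sum>p<n. \<Sum>q<n. \<Sum>i<m. \<Sum>j<m. f i p j q k)"
proof -
  have "(\<Sum>i<m. \<Sum>p<n. \<Sum>j<m. \<Sum>q<n. \<Sum>k<m. f i p j q k) = (\<Sum>i<m. \<Sum>p<n. \<Sum>q<n. \<Sum>j<m. \<Sum>k<m. f i p j q k)"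
    by (intro sum.cong refl sum.swap)
  also have "\<dots> = (\<Sum>i<m. \<Sum>p<n. \<Sum>q<n. \<Sum>k<m. \<Sum>j<m. f i p j q k)"
    by (intro sum.cong refl sum.swap)
  also have "\<dots> = (\<Sum>i<m. \<Sum>p<n. \<Sum>k<m. \<Sum>q<n. \<Sum>j<m. f i p j q k)"
    by (intro sum.cong refl sum.swap)
  also have "\<dots> = (\<Sum>i<m. \<Sum>k<m. \<Sum>p<n. \<Sum>q<n. \<Sum>j<m. f i p j q k)"
    by (intro sum.cong refl sum.swap)
  also have "\<dots> = (\<Sum>k<m. \<Sum>i<m. \<Sum>p<n. \<Sum>q<n. \<Sum>j<m. f i p j q k)"
    by (rule sum.swap)
  also have "\<dots> = (\<Sum>k<m. \<Sum>p<n. \<Sum>i<m. \<Sum>q<n. \<Sum>j<m. f i p j q k)"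
    by (intro sum.cong refl sum.swap)
  also have "\<dots> = (\<Sum>k<m. \<Sum>p<n. \<Sum>q<n. \<Sum>i<m. \<Sum>j<m. f i p j q k)"
    by (intro sum.cong refl sum.swap)
  finally show ?thesis .
qed

text \<open>Factoring the left matrix turns the quadratic form of a Kronecker product into a sum of forms of the right matrix.\<close>

lemma psd_matrix_kron:
  assumes A: "psd_matrix m A" and B: "psd_matrix n B"
  shows "psd_matrix (m * n) (kron n A B)"
  unfolding psd_matrix_def
proof (intro conjI allI impI)
  show "kron n A B i j = kron n A B j i" if "i < m * n" "j < m * n" for i j
    using psd_matrixD(2)[OF A] psd_matrixD(2)[OF B] div_mod_less[OF that(1)] div_mod_less[OF that(2)]
    by (simp add: kron_def)
  fix v
  obtain W where W: "\<And>i j. i < m \<Longrightarrow> j < m \<Longrightarrow> A i j = (\<Sum>k<m. W k i * W k j)"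
    using psd_matrix_gram[OF A] by blast
  \<comment> \<open>The vector \<open>v\<close> is read as an array with \<open>m\<close> rows of
    length \<open>n\<close>, and \<open>u k\<close> is its contraction with row \<open>k\<close> of
    the Gram factor.\<close>
  define u where "u k p = (\<Sum>i<m. v (p + i * n) * W k i)" for k p
  have "(\<Sum>i<m*n. \<Sum>j<m*n. v i * kron n A B i j * v j) =
    (\<Sum>i<m. \<Sum>p<n. \<Sum>j<m. \<Sum>q<n. v (p + i * n) * (A i j * B p q) * v (q + j * n))"
    unfolding sum_mult_product by (intro sum.cong) (auto simp: kron_def)
  also have "\<dots> = (\<Sum>i<m. \<Sum>p<n. \<Sum>j<m. \<Sum>q<n. \<Sum>k<m.
      (v (p + i * n) * W k i) * B p q * (v (q + j * n) * W k j))"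
    by (intro sum.cong) (auto simp: W sum_distrib_left sum_distrib_right mult_ac)
  also have "\<dots> = (\<Sum>k<m. \<Sum>p<n. \<Sum>q<n. \<Sum>i<m. \<Sum>j<m.
      (v (p + i * n) * W k i) * B p q * (v (q + j * n) * W k j))"
    by (rule sum_rearrange5)
  also have "\<dots> = (\<Sum>k<m. \<Sum>p<n. \<Sum>q<n. u k p * B p q * u k q)"
    \<comment> \<open>The instance limits distribution to the factor \<open>B p q\<close>, so that
      \<open>sum_product\<close> can still expand the product of the two contractions.\<close>
    unfolding u_def by (intro sum.cong refl) (simp only: sum_distrib_right[of _ _ "B _ _"] sum_product)
  also have "\<dots> \<ge> 0" by (intro sum_nonneg psd_matrixD(1)[OF B])
  finally show "0 \<le> (\<Sum>i<m*n. \<Sum>j<m*n. v i * kron n A B i j * v j)" .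
qed

text \<open>On a product vector the form of a Kronecker product factors. With kernel values for
  \<open>g\<close> and \<open>h\<close> this becomes the product of two models.\<close>

lemma kron_form_product:
  fixes A B :: "nat \<Rightarrow> nat \<Rightarrow> real"
  assumes "\<And>i. i < m * n \<Longrightarrow> f i = g (i div n) * h (i mod n)"
  shows "(\<Sum>i<m*n. \<Sum>j<m*n. kron n A B i j * f i * f j) =
    (\<Sum>i<m. \<Sum>j<m. A i j * g i * g j) * (\<Sum>p<n. \<Sum>q<n. B p q * h p * h q)"
proof -
  have "(\<Sum>i<m*n. \<Sum>j<m*n. kron n A B i j * f i * f j) =
    (\<Sum>i<m*n. \<Sum>j<m*n. kron n A B i j * (g (i div n) * h (i mod n)) * (g (j div n) * h (j mod n)))"
    using assms by (intro sum.cong) auto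
  also have "\<dots> = (\<Sum>i<m. \<Sum>p<n. \<Sum>j<m. \<Sum>q<n. (A i j * g i * g j) * (B p q * h p * h q))"
    unfolding sum_mult_product by (intro sum.cong) (auto simp: kron_def)
  also have "\<dots> = (\<Sum>i<m. \<Sum>j<m. \<Sum>p<n. \<Sum>q<n. (A i j * g i * g j) * (B p q * h p * h q))"
    by (intro sum.cong refl sum.swap)
  also have "\<dots> = (\<Sum>i<m. \<Sum>j<m. A i j * g i * g j) * (\<Sum>p<n. \<Sum>q<n. B p q * h p * h q)"
    unfolding sum_distrib_right unfolding sum_distrib_left ..
  finally show ?thesis .
qed

subsection \<open>Gaussian kernels\<close>

lemma exp_minus_mult: "exp (- x) * exp (- y) = exp (- (x + y))" for x y :: real
  by (simp add: exp_add[symmetric])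

lemma sum_Basis_Pair:
  fixes f :: "'a::euclidean_space \<times> 'b::euclidean_space \<Rightarrow> real"
  shows "sum f Basis = (\<Sum>b\<in>Basis. f (b, 0)) + (\<Sum>b\<in>Basis. f (0, b))"
proof -
  have "inj_on (\<lambda>u::'a. (u, 0::'b)) Basis" "inj_on (\<lambda>u::'b. (0::'a, u)) Basis"
    by (auto intro!: inj_onI)
  then show ?thesis
    unfolding Basis_prod_def by (subst sum.union_disjoint) (auto simp: sum.reindex)
qed

lemma gkernel_Pair: "gkernel (\<eta>, \<theta>) (u, x) (a, b) = gkernel \<eta> u a * gkernel \<theta> x b"
  unfolding gkernel_def exp_minus_mult by (simp add: sum_Basis_Pair)

lemma gkernel_commute: "gkernel \<eta> x y = gkernel \<eta> y x"
  by (simp add: gkernel_def inner_diff_left power2_commute)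

lemma continuous_on_gkernel: "continuous_on S (\<lambda>u. gkernel \<eta> u a)"
  unfolding gkernel_def by (intro continuous_intros)

text \<open>The square is completed in each coordinate separately; the remainder free of
  \<open>x\<close> is the exponent of \<open>overlap\<close>. Positivity keeps the summed precision
  away from zero.\<close>

lemma gkernel_mult:
  fixes x :: "'a::euclidean_space"
  assumes "\<And>b. b \<in> Basis \<Longrightarrow> 0 < \<eta> \<bullet> b" "\<And>b. b \<in> Basis \<Longrightarrow> 0 < \<theta> \<bullet> b"
  shows "gkernel \<eta> x a * gkernel \<theta> x b =
    overlap \<eta> a \<theta> b * gkernel (\<eta> + \<theta>) x (weighted_mean \<eta> a \<theta> b)"
proof -
  have *: "p * (y - c)\<^sup>2 + q * (y - d)\<^sup>2 =
    p * q / (p + q) * (c - d)\<^sup>2 + (p + q) * (y - (p * c + q * d) / (p + q))\<^sup>2"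
    if "p > 0" "q > 0" for p q y c d :: real
  proof -
    \<comment> \<open>Naming the sum and eliminating \<open>p\<close> turns the denominator into a
      single variable that \<open>field_simps\<close> can clear.\<close>
    define s where "s = p + q"
    have "s \<noteq> 0" and p: "p = s - q" using that by (simp_all add: s_def)
    then show ?thesis unfolding p by (simp add: field_simps power2_eq_square)
  qed
  have "(\<Sum>e\<in>Basis. (\<eta> \<bullet> e) * ((x - a) \<bullet> e)\<^sup>2) + (\<Sum>e\<in>Basis. (\<theta> \<bullet> e) * ((x - b) \<bullet> e)\<^sup>2) =
    (\<Sum>e\<in>Basis. (\<eta> \<bullet> e) * (\<theta> \<bullet> e) / (\<eta> \<bullet> e + \<theta> \<bullet> e) * ((a - b) \<bullet> e)\<^sup>2) +
    (\<Sum>e\<in>Basis. ((\<eta> + \<theta>) \<bullet> e) * ((x - weighted_mean \<eta> a \<theta> b) \<bullet> e)\<^sup>2)"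
    unfolding sum.distrib[symmetric]
    by (intro sum.cong refl) (simp add: weighted_mean_def inner_diff_left inner_add_left * assms)
  then show ?thesis
    unfolding gkernel_def overlap_def by (simp only: exp_minus_mult)
qed

text \<open>The parallelogram identity in each coordinate: the squared distances to \<open>a\<close>
  and \<open>b\<close> add up to half their mutual squared distance plus twice the squared distance
  to the midpoint.\<close>

lemma gkernel_mult_same:
  "gkernel \<eta> u a * gkernel \<eta> u b =
    gkernel ((1 / 2) *\<^sub>R \<eta>) a b * gkernel (2 *\<^sub>R \<eta>) u ((1 / 2) *\<^sub>R (a + b))"
proof -
  have "(\<Sum>e\<in>Basis. (\<eta> \<bullet> e) * ((u - a) \<bullet> e)\<^sup>2) + (\<Sum>e\<in>Basis. (\<eta> \<bullet> e) * ((u - b) \<bullet> e)\<^sup>2) =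
    (\<Sum>e\<in>Basis. (((1 / 2) *\<^sub>R \<eta>) \<bullet> e) * ((a - b) \<bullet> e)\<^sup>2) +
    (\<Sum>e\<in>Basis. ((2 *\<^sub>R \<eta>) \<bullet> e) * ((u - (1 / 2) *\<^sub>R (a + b)) \<bullet> e)\<^sup>2)"
    unfolding sum.distrib[symmetric]
    by (intro sum.cong refl) (simp add: inner_diff_left inner_add_left field_simps power2_eq_square)
  then show ?thesis
    unfolding gkernel_def by (simp only: exp_minus_mult)
qed

subsection \<open>Integration over the cube\<close>

lemma cube_eq_box: "cube = box (- One) (One :: 'a::euclidean_space)"
  by (auto simp: cube_def box_def)

lemma cube_sets [measurable, simp]: "(cube :: 'a::euclidean_space set) \<in> sets borel"
  by (simp add: cube_eq_box)

text \<open>Continuity on the whole space gives integrability over the compact closed cube, which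
  then restricts to the open one.\<close>

lemma set_integrable_cube:
  fixes f :: "'a::euclidean_space \<Rightarrow> real"
  assumes "continuous_on UNIV f"
  shows "set_integrable lborel cube f"
proof -
  have "set_integrable lborel (cbox (- One) One) f"
    unfolding set_integrable_def
    by (intro borel_integrable_compact continuous_on_subset[OF assms]) auto
  then show ?thesis
    by (rule set_integrable_subset) (auto simp: cube_eq_box box_def cbox_def less_imp_le)
qed

section \<open>The error function and Gaussian integrals over the cube\<close>

lemma erf_deriv: "(erf has_real_derivative 2 / sqrt pi * exp (- x\<^sup>2)) (at x)"
proof -
  let ?f = "\<lambda>t::real. exp (- t\<^sup>2)" and ?b = "\<bar>x\<bar> + 1"
  have "((\<lambda>u. LBINT y=ereal 0..ereal u. ?f y) has_vector_derivative ?f x) (at x within {-?b..?b})"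
    by (intro interval_integral_FTC2) (auto intro!: continuous_intros)
  then have "((\<lambda>u. LBINT y=ereal 0..ereal u. ?f y) has_vector_derivative ?f x) (at x within {-?b<..<?b})"
    by (rule has_vector_derivative_within_subset) auto
  then have "((\<lambda>u. LBINT y=ereal 0..ereal u. ?f y) has_vector_derivative ?f x) (at x)"
    by (subst (asm) has_vector_derivative_within_open) auto
  then have "((\<lambda>u. LBINT y=0..ereal u. ?f y) has_real_derivative ?f x) (at x)"
    by (simp add: has_real_derivative_iff_has_vector_derivative zero_ereal_def)
  from DERIV_cmult[OF this, of "2 / sqrt pi"] show ?thesis
    unfolding erf_def[abs_def] by simp
qed

lemma erf_minus: "erf (- x) = - erf x"
proof -
  have "(LBINT t=0..ereal (- x). exp (- t\<^sup>2)) = (LBINT t=ereal x..0. exp (- t\<^sup>2))"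
    by (subst interval_integral_reflect) simp
  then show ?thesis
    by (simp add: erf_def interval_integral_endpoints_reverse[of "ereal x" 0])
qed

lemma gauss_integral_unit_interval:
  assumes "0 < \<eta>"
  shows "(LINT t:{-1<..<1}|lborel. exp (- (\<eta> * (t - c)\<^sup>2))) =
    sqrt pi / (2 * sqrt \<eta>) * (erf (sqrt \<eta> * (1 - c)) + erf (sqrt \<eta> * (1 + c)))"
proof -
  define F where "F t = sqrt pi / (2 * sqrt \<eta>) * erf (sqrt \<eta> * (t - c))" for t
  have F: "(F has_real_derivative exp (- (\<eta> * (t - c)\<^sup>2))) (at t)" for t
  proof -
    have "((\<lambda>t. erf (sqrt \<eta> * (t - c))) has_real_derivative
      2 / sqrt pi * exp (- (sqrt \<eta> * (t - c))\<^sup>2) * sqrt \<eta>) (at t)"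
      by (rule DERIV_chain2[OF erf_deriv]) (auto intro!: derivative_eq_intros)
    from DERIV_cmult[OF this, of "sqrt pi / (2 * sqrt \<eta>)"] show ?thesis
      unfolding F_def[abs_def] using assms by (simp add: power_mult_distrib)
  qed
  have "(LINT t:{-1<..<1}|lborel. exp (- (\<eta> * (t - c)\<^sup>2))) =
    (LBINT t=ereal (-1)..ereal 1. exp (- (\<eta> * (t - c)\<^sup>2)))"
    by (subst interval_integral_Ioo) auto
  also have "\<dots> = F 1 - F (-1)"
  proof (rule interval_integral_FTC_finite)
    show "continuous_on {min (-1) 1..max (-1) 1} (\<lambda>t. exp (- (\<eta> * (t - c)\<^sup>2)))"
      by (intro continuous_intros)
    show "(F has_vector_derivative exp (- (\<eta> * (t - c)\<^sup>2))) (at t within {min (-1) 1..max (-1) 1})" for t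
      by (rule has_vector_derivative_at_within) (rule F[unfolded has_real_derivative_iff_has_vector_derivative])
  qed
  \<comment> \<open>Oddness of \<open>erf\<close> turns the difference of the endpoint values into
    the sum that appears in \<open>cube_gauss\<close>.\<close>
  also have "F (-1) = - (sqrt pi / (2 * sqrt \<eta>) * erf (sqrt \<eta> * (1 + c)))"
    using erf_minus[of "sqrt \<eta> * (1 + c)"] by (simp add: F_def algebra_simps)
  finally show ?thesis by (simp add: F_def distrib_left)
qed

text \<open>Fubini for functions that factor over the coordinates: \<open>lborel\<close> is the
  image of the product of one-dimensional Lebesgue measures under the map that assembles a vector
  from its coordinates.\<close>

lemma integral_lborel_prod:
  fixes f :: "'a::euclidean_space \<Rightarrow> real \<Rightarrow> real"
  assumes "\<And>b. b \<in> Basis \<Longrightarrow> integrable lborel (f b)"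
  shows "(\<integral>x. (\<Prod>b\<in>Basis. f b (x \<bullet> b)) \<partial>lborel) = (\<Prod>b\<in>Basis. \<integral>t. f b t \<partial>lborel)"
proof -
  interpret product_sigma_finite "\<lambda>_::'a. lborel :: real measure" ..
  have [measurable]: "b \<in> Basis \<Longrightarrow> f b \<in> borel_measurable borel" for b
    using borel_measurable_integrable[OF assms] by simp
  have "(\<integral>x. (\<Prod>b\<in>Basis. f b (x \<bullet> b)) \<partial>lborel) =
    (\<integral>y. (\<Prod>b\<in>Basis. f b ((\<Sum>e\<in>Basis. y e *\<^sub>R e) \<bullet> b)) \<partial>(\<Pi>\<^sub>M b\<in>Basis. lborel))"
    by (subst lborel_eq, subst integral_distr) simp_all
  also have "\<dots> = (\<integral>y. (\<Prod>b\<in>Basis. f b (y b)) \<partial>(\<Pi>\<^sub>M b\<in>(Basis::'a set). lborel))"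
    by (intro Bochner_Integration.integral_cong refl prod.cong) simp
  also have "\<dots> = (\<Prod>b\<in>Basis. \<integral>t. f b t \<partial>lborel)"
    by (rule product_integral_prod) (use assms in auto)
  finally show ?thesis .
qed

lemma cube_integral_gkernel:
  fixes c :: "'a::euclidean_space"
  assumes "\<And>b. b \<in> Basis \<Longrightarrow> 0 < \<eta> \<bullet> b"
  shows "(LINT u:cube|lborel. gkernel \<eta> u c) = cube_gauss \<eta> c"
proof -
  define f where "f b t = indicator {-1<..<1} t *\<^sub>R exp (- ((\<eta> \<bullet> b) * (t - c \<bullet> b)\<^sup>2))" for b t
  have "(LINT u:cube|lborel. gkernel \<eta> u c) = (\<integral>u. (\<Prod>b\<in>Basis. f b (u \<bullet> b)) \<partial>lborel)"
    unfolding set_lebesgue_integral_def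
  proof (intro Bochner_Integration.integral_cong refl)
    fix u :: 'a
    have ind: "indicator cube u = (\<Prod>b\<in>Basis. indicator {-1<..<1} (u \<bullet> b) :: real)"
      by (auto simp: cube_def indicator_def)
    show "indicator cube u *\<^sub>R gkernel \<eta> u c = (\<Prod>b\<in>Basis. f b (u \<bullet> b))"
      by (simp add: ind f_def prod.distrib gkernel_def exp_sum sum_negf[symmetric] inner_diff_left)
  qed
  also have "\<dots> = (\<Prod>b\<in>Basis. \<integral>t. f b t \<partial>lborel)"
  proof (rule integral_lborel_prod)
    fix b :: 'a
    \<comment> \<open>At type \<open>real\<close> the cube is the interval from -1 to 1, so the
      general integrability lemma also serves each one-dimensional factor.\<close>
    have "set_integrable lborel cube (\<lambda>t::real. exp (- ((\<eta> \<bullet> b) * (t - c \<bullet> b)\<^sup>2)))"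
      by (intro set_integrable_cube continuous_intros)
    moreover have "cube = {-1<..<1::real}" by (auto simp: cube_def)
    ultimately show "integrable lborel (f b)"
      by (simp add: set_integrable_def f_def[abs_def])
  qed
  also have "\<dots> = cube_gauss \<eta> c"
    unfolding cube_gauss_def f_def set_lebesgue_integral_def[symmetric]
    by (intro prod.cong refl gauss_integral_unit_interval assms)
  finally show ?thesis .
qed

lemma cube_integral_gkernel_mult:
  assumes "\<And>b. b \<in> Basis \<Longrightarrow> 0 < \<eta> \<bullet> b"
  shows "(LINT u:cube|lborel. gkernel \<eta> u a * gkernel \<eta> u b) = cube_gram \<eta> a b"
  unfolding gkernel_mult_same cube_gram_def
  by (simp add: cube_integral_gkernel assms)

lemma set_integrable_gkernel_mult:
  "set_integrable lborel cube (\<lambda>u. gkernel \<eta> u a * gkernel \<eta> u b)"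
  by (intro set_integrable_cube continuous_intros continuous_on_gkernel)

text \<open>Linearity of the integral over finitely many kernel products. Since \<open>C\<close> is
  arbitrary it can absorb factors constant in \<open>u\<close>, which serves the marginal as well as
  the total integral.\<close>

lemma cube_integral_form:
  fixes C :: "nat \<Rightarrow> nat \<Rightarrow> real"
  assumes "\<And>b. b \<in> Basis \<Longrightarrow> 0 < \<eta> \<bullet> b"
  shows "(LINT u:cube|lborel. \<Sum>i<n. \<Sum>j<n. C i j * gkernel \<eta> u (a i) * gkernel \<eta> u (a j)) =
    (\<Sum>i<n. \<Sum>j<n. C i j * cube_gram \<eta> (a i) (a j))"
proof -
  have int: "integrable lborel (\<lambda>u. indicator cube u *\<^sub>R (C i j * (gkernel \<eta> u (a i) * gkernel \<eta> u (a j))))" for i j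
    using set_integrable_mult_right[OF set_integrable_gkernel_mult[of \<eta> "a i" "a j"], of "C i j"]
    unfolding set_integrable_def by blast
  have "(LINT u:cube|lborel. \<Sum>i<n. \<Sum>j<n. C i j * gkernel \<eta> u (a i) * gkernel \<eta> u (a j)) =
    (\<Sum>i<n. \<Sum>j<n. LINT u:cube|lborel. C i j * (gkernel \<eta> u (a i) * gkernel \<eta> u (a j)))"
    unfolding set_lebesgue_integral_def scaleR_sum_right mult.assoc
    by (subst Bochner_Integration.integral_sum, intro Bochner_Integration.integrable_sum int)
       (intro sum.cong refl Bochner_Integration.integral_sum int)
  then show ?thesis
    by (simp add: cube_integral_gkernel_mult assms)
qed

lemma psd_matrix_cube_gram:
  fixes a :: "nat \<Rightarrow> 'a::euclidean_space"
  assumes C: "psd_matrix n C" and \<eta>: "\<And>b. b \<in> Basis \<Longrightarrow> 0 < \<eta> \<bullet> b"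
  shows "psd_matrix n (\<lambda>i j. C i j * cube_gram \<eta> (a i) (a j))"
  unfolding psd_matrix_def
proof (intro conjI allI impI)
  show "C i j * cube_gram \<eta> (a i) (a j) = C j i * cube_gram \<eta> (a j) (a i)" if "i < n" "j < n" for i j
    using psd_matrixD(2)[OF C that] by (simp add: cube_gram_def gkernel_commute add.commute)
  fix v :: "nat \<Rightarrow> real"
  have "0 \<le> (LINT u:cube|lborel. \<Sum>i<n. \<Sum>j<n. (v i * C i j * v j) * gkernel \<eta> u (a i) * gkernel \<eta> u (a j))"
    unfolding set_lebesgue_integral_def
  proof (intro Bochner_Integration.integral_nonneg scaleR_nonneg_nonneg)
    show "0 \<le> (\<Sum>i<n. \<Sum>j<n. (v i * C i j * v j) * gkernel \<eta> u (a i) * gkernel \<eta> u (a j))" for u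
      \<comment> \<open>For fixed \<open>u\<close> the kernel values are absorbed into the test
        vector, so the integrand is a value of the form of \<open>C\<close>.\<close>
      using psd_matrixD(1)[OF C, of "\<lambda>i. v i * gkernel \<eta> u (a i)"] by (simp add: mult_ac)
  qed simp
  then show "0 \<le> (\<Sum>i<n. \<Sum>j<n. v i * (C i j * cube_gram \<eta> (a i) (a j)) * v j)"
    by (subst (asm) cube_integral_form[OF \<eta>]) (simp_all add: mult_ac)
qed

subsection \<open>Operations on parameters\<close>

lemma psd_order_PSD_Params [simp]: "psd_order (PSD_Params xs \<eta> C) = length xs"
  by (simp add: psd_order_def)

lemma psd_order_mult [simp]: "psd_order (psd_mult P R) = psd_order P * psd_order R"
  by (simp add: psd_mult_def Let_def psd_order_def)

lemma psd_order_mult_fst [simp]: "psd_order (psd_mult_fst P R) = psd_order P * psd_order R"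
  by (simp add: psd_mult_fst_def Let_def psd_order_def)

lemma valid_paramsD:
  assumes "valid_params P"
  shows "b \<in> Basis \<Longrightarrow> 0 < precision P \<bullet> b" and "psd_matrix (psd_order P) (coeffs P)"
  using assms by (auto simp: valid_params_def)

lemma valid_params_prodD:
  assumes "valid_params P"
  shows "b \<in> Basis \<Longrightarrow> 0 < fst (precision P) \<bullet> b" and "c \<in> Basis \<Longrightarrow> 0 < snd (precision P) \<bullet> c"
  using valid_paramsD(1)[OF assms, of "(b, 0)"] valid_paramsD(1)[OF assms, of "(0, c)"]
  by (auto simp: inner_prod_def Basis_prod_def)

lemma psd_eval_PSD_Params:
  "psd_eval (PSD_Params xs \<eta> C) x =
    (\<Sum>i<length xs. \<Sum>j<length xs. C i j * gkernel \<eta> x (xs ! i) * gkernel \<eta> x (xs ! j))"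
  by (simp add: psd_eval_def)

section \<open>Products and partial evaluation\<close>

lemma valid_params_mult:
  assumes "valid_params P" "valid_params R"
  shows "valid_params (psd_mult P R)"
  unfolding valid_params_def psd_order_mult
proof
  show "\<forall>b\<in>Basis. 0 < precision (psd_mult P R) \<bullet> b"
    using valid_paramsD(1)[OF assms(1)] valid_paramsD(1)[OF assms(2)]
    by (simp add: psd_mult_def Let_def inner_add_left add_pos_pos)
  show "psd_matrix (psd_order P * psd_order R) (coeffs (psd_mult P R))"
    using assms[THEN valid_paramsD(2)]
    by (simp add: psd_mult_def Let_def psd_matrix_congruence psd_matrix_kron)
qed

lemma psd_eval_mult:
  assumes "valid_params P" "valid_params R"
  shows "psd_eval (psd_mult P R) x = psd_eval P x * psd_eval R x"
proof -
  let ?m = "psd_order P" and ?n = "psd_order R"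
  let ?pairs = "List.product (anchors P) (anchors R)"
  define w where "w i = (case ?pairs ! i of (a, b) \<Rightarrow> overlap (precision P) a (precision R) b)" for i
  \<comment> \<open>Entry \<open>i\<close> of the product list pairs the anchors numbered
    \<open>i div ?n\<close> and \<open>i mod ?n\<close>, as in \<open>kron\<close>. By
    \<open>gkernel_mult\<close>, \<open>f i\<close> is the product of their two kernels.\<close>
  define f where "f i = w i * gkernel (precision P + precision R) x
    (case ?pairs ! i of (a, b) \<Rightarrow> weighted_mean (precision P) a (precision R) b)" for i
  have "psd_eval (psd_mult P R) x =
    (\<Sum>i<?m * ?n. \<Sum>j<?m * ?n. kron ?n (coeffs P) (coeffs R) i j * f i * f j)"
    unfolding psd_mult_def Let_def psd_eval_PSD_Params f_def w_def
    by (intro sum.cong) (auto simp: psd_order_def mult_ac)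
  also have "\<dots> = psd_eval P x * psd_eval R x"
    unfolding psd_eval_def
  proof (rule kron_form_product)
    fix i assume "i < ?m * ?n"
    then show "f i = gkernel (precision P) x (anchors P ! (i div ?n)) *
        gkernel (precision R) x (anchors R ! (i mod ?n))"
      by (simp add: f_def w_def product_nth psd_order_def gkernel_mult assms[THEN valid_paramsD(1)])
  qed
  finally show ?thesis .
qed

lemma valid_params_mult_fst:
  assumes "valid_params P" "valid_params R"
  shows "valid_params (psd_mult_fst P R)"
  unfolding valid_params_def psd_order_mult_fst
proof
  show "\<forall>b\<in>Basis. 0 < precision (psd_mult_fst P R) \<bullet> b"
    using valid_paramsD(1)[OF assms(1)] valid_params_prodD[OF assms(2)]
    by (auto simp: psd_mult_fst_def Let_def Basis_prod_def inner_add_left add_pos_pos)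
  show "psd_matrix (psd_order P * psd_order R) (coeffs (psd_mult_fst P R))"
    using assms[THEN valid_paramsD(2)]
    by (simp add: psd_mult_fst_def Let_def psd_matrix_congruence psd_matrix_kron)
qed

text \<open>Works like the plain product, except that only the \<open>u\<close>-factor of the kernel
  on the product space is merged with the kernel of \<open>P\<close>; the \<open>x\<close>-factor is
  carried along unchanged.\<close>

lemma psd_eval_mult_fst:
  assumes "valid_params P" "valid_params R"
  shows "psd_eval (psd_mult_fst P R) (u, x) = psd_eval P u * psd_eval R (u, x)"
proof -
  let ?m = "psd_order P" and ?n = "psd_order R" and ?\<theta> = "fst (precision R)"
  let ?pairs = "List.product (anchors P) (anchors R)"
  define w where "w i = (case ?pairs ! i of (a, b) \<Rightarrow> overlap (precision P) a ?\<theta> (fst b))" for i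
  define f where "f i = w i * gkernel (precision P + ?\<theta>, snd (precision R)) (u, x)
    (case ?pairs ! i of (a, b) \<Rightarrow> (weighted_mean (precision P) a ?\<theta> (fst b), snd b))" for i
  have "psd_eval (psd_mult_fst P R) (u, x) =
    (\<Sum>i<?m * ?n. \<Sum>j<?m * ?n. kron ?n (coeffs P) (coeffs R) i j * f i * f j)"
    unfolding psd_mult_fst_def Let_def psd_eval_PSD_Params f_def w_def
    by (intro sum.cong) (auto simp: psd_order_def mult_ac)
  also have "\<dots> = psd_eval P u * psd_eval R (u, x)"
    unfolding psd_eval_def
  proof (rule kron_form_product)
    fix i assume i: "i < ?m * ?n"
    obtain b c where bc: "anchors R ! (i mod ?n) = (b, c)" by fastforce
    obtain \<theta> \<theta>' where prec: "precision R = (\<theta>, \<theta>')" by fastforce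
    show "f i = gkernel (precision P) u (anchors P ! (i div ?n)) *
        gkernel (precision R) (u, x) (anchors R ! (i mod ?n))"
      using i bc prec valid_paramsD(1)[OF assms(1)] valid_params_prodD(1)[OF assms(2)]
      by (simp add: f_def w_def product_nth psd_order_def gkernel_Pair mult.assoc[symmetric] gkernel_mult)
  qed
  finally show ?thesis .
qed

lemma valid_params_partial_eval:
  assumes "valid_params P" shows "valid_params (psd_partial_eval P z)"
  using valid_params_prodD(1)[OF assms] psd_matrix_congruence[OF valid_paramsD(2)[OF assms]]
  by (simp add: valid_params_def psd_partial_eval_def Let_def psd_order_def)

lemma psd_eval_partial_eval: "psd_eval (psd_partial_eval P z) x = psd_eval P (x, z)"
proof -
  have "gkernel (precision P) (x, z) p =
    gkernel (fst (precision P)) x (fst p) * gkernel (snd (precision P)) z (snd p)" for p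
    using gkernel_Pair[of "fst (precision P)" "snd (precision P)" x z "fst p" "snd p"] by simp
  then show ?thesis
    unfolding psd_partial_eval_def Let_def psd_eval_PSD_Params
    unfolding psd_eval_def by (intro sum.cong) (auto simp: psd_order_def mult_ac)
qed

section \<open>Merging repeated anchor points\<close>

text \<open>The fibres of \<open>g\<close> partition the indices and the weights are constant on
  each fibre, so summing over fibres first changes nothing.\<close>

lemma sum_over_classes:
  fixes C :: "nat \<Rightarrow> nat \<Rightarrow> real" and g :: "nat \<Rightarrow> nat"
  assumes "g ` {..<n} \<subseteq> {..<r}"
  shows "(\<Sum>p<r. \<Sum>q<r. v p * (\<Sum>i\<in>{i \<in> {..<n}. g i = p}. \<Sum>j\<in>{j \<in> {..<n}. g j = q}. C i j) * v q) =
    (\<Sum>i<n. \<Sum>j<n. v (g i) * C i j * v (g j))"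
proof -
  have grp: "(\<Sum>p<r. \<Sum>i\<in>{i \<in> {..<n}. g i = p}. h p i) = (\<Sum>i<n. h (g i) i)" for h :: "nat \<Rightarrow> nat \<Rightarrow> real"
  proof -
    have "(\<Sum>p<r. \<Sum>i\<in>{i \<in> {..<n}. g i = p}. h p i) = (\<Sum>p<r. \<Sum>i\<in>{i \<in> {..<n}. g i = p}. h (g i) i)"
      by (intro sum.cong) auto
    then show ?thesis using sum.group[OF _ _ assms, of "\<lambda>i. h (g i) i"] by simp
  qed
  have "(\<Sum>p<r. \<Sum>q<r. v p * (\<Sum>i\<in>{i \<in> {..<n}. g i = p}. \<Sum>j\<in>{j \<in> {..<n}. g j = q}. C i j) * v q) =
    (\<Sum>p<r. \<Sum>q<r. \<Sum>i\<in>{i \<in> {..<n}. g i = p}. \<Sum>j\<in>{j \<in> {..<n}. g j = q}. v p * C i j * v q)"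
    by (simp add: sum_distrib_left sum_distrib_right)
  \<comment> \<open>The exchange puts each fibre sum right after the sum over its label, so that
    \<open>grp\<close> applies once to each pair.\<close>
  also have "\<dots> = (\<Sum>p<r. \<Sum>i\<in>{i \<in> {..<n}. g i = p}. \<Sum>q<r. \<Sum>j\<in>{j \<in> {..<n}. g j = q}. v p * C i j * v q)"
    by (intro sum.cong refl sum.swap)
  also have "\<dots> = (\<Sum>i<n. \<Sum>j<n. v (g i) * C i j * v (g j))"
    by (simp only: grp)
  finally show ?thesis .
qed

text \<open>Here \<open>g\<close> maps an index to the position of its anchor in the list without
  repetitions. The collected form at \<open>v\<close> is then the original form at the pullback of
  \<open>v\<close> along \<open>g\<close>. Kernel values as \<open>v\<close> give invariance of the
  function, arbitrary \<open>v\<close> gives positivity.\<close>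

lemma psd_collect_form:
  obtains g :: "nat \<Rightarrow> nat" where
    "\<And>i. i < psd_order P \<Longrightarrow> anchors (psd_collect P) ! g i = anchors P ! i"
    "\<And>v. (\<Sum>p<psd_order (psd_collect P). \<Sum>q<psd_order (psd_collect P). v p * coeffs (psd_collect P) p q * v q) =
      (\<Sum>i<psd_order P. \<Sum>j<psd_order P. v (g i) * coeffs P i j * v (g j))"
proof -
  define xs where "xs = remdups (anchors P)"
  have "\<forall>i. \<exists>p. i < psd_order P \<longrightarrow> p < length xs \<and> xs ! p = anchors P ! i"
    by (auto simp: xs_def psd_order_def in_set_conv_nth[symmetric])
  then obtain g where g: "\<And>i. i < psd_order P \<Longrightarrow> g i < length xs \<and> xs ! g i = anchors P ! i"
    by metis
  \<comment> \<open>Distinctness of \<open>xs\<close> makes positions unique, hence the classes of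
    equal anchors are the fibres of \<open>g\<close>.\<close>
  have cls: "{i. i < psd_order P \<and> anchors P ! i = xs ! p} = {i \<in> {..<psd_order P}. g i = p}" if "p < length xs" for p
    using g that nth_eq_iff_index_eq[of xs] by (auto simp: xs_def) metis+
  have collect: "psd_collect P = PSD_Params xs (precision P)
    (\<lambda>p q. \<Sum>i\<in>{i. i < psd_order P \<and> anchors P ! i = xs ! p}. \<Sum>j\<in>{i. i < psd_order P \<and> anchors P ! i = xs ! q}. coeffs P i j)"
    by (simp add: psd_collect_def Let_def xs_def)
  show thesis
  proof (rule that[of g])
    show "anchors (psd_collect P) ! g i = anchors P ! i" if "i < psd_order P" for i
      using g[OF that] by (simp add: collect)
    show "(\<Sum>p<psd_order (psd_collect P). \<Sum>q<psd_order (psd_collect P). v p * coeffs (psd_collect P) p q * v q) =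
      (\<Sum>i<psd_order P. \<Sum>j<psd_order P. v (g i) * coeffs P i j * v (g j))" for v
    proof -
      have "g ` {..<psd_order P} \<subseteq> {..<length xs}" using g by auto
      from sum_over_classes[OF this, of v "coeffs P"] show ?thesis
        by (simp add: collect cls)
    qed
  qed
qed

lemma precision_collect [simp]: "precision (psd_collect P) = precision P"
  by (simp add: psd_collect_def Let_def)

lemma psd_eval_collect: "psd_eval (psd_collect P) x = psd_eval P x"
proof -
  obtain g where g:
    "\<And>i. i < psd_order P \<Longrightarrow> anchors (psd_collect P) ! g i = anchors P ! i"
    "\<And>v. (\<Sum>p<psd_order (psd_collect P). \<Sum>q<psd_order (psd_collect P). v p * coeffs (psd_collect P) p q * v q) =
      (\<Sum>i<psd_order P. \<Sum>j<psd_order P. v (g i) * coeffs P i j * v (g j))"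
    using psd_collect_form by blast
  have "psd_eval (psd_collect P) x = (\<Sum>p<psd_order (psd_collect P). \<Sum>q<psd_order (psd_collect P).
    gkernel (precision P) x (anchors (psd_collect P) ! p) * coeffs (psd_collect P) p q *
    gkernel (precision P) x (anchors (psd_collect P) ! q))"
    by (simp add: psd_eval_def mult_ac)
  also have "\<dots> = psd_eval P x"
    by (subst g(2)) (simp add: g(1) psd_eval_def mult_ac)
  finally show ?thesis .
qed

lemma valid_params_collect:
  assumes "valid_params P" shows "valid_params (psd_collect P)"
  unfolding valid_params_def psd_matrix_def
proof (intro conjI allI impI)
  show "\<forall>b\<in>Basis. 0 < precision (psd_collect P) \<bullet> b"
    using valid_paramsD(1)[OF assms] by simp
  show "coeffs (psd_collect P) p q = coeffs (psd_collect P) q p" for p q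
    unfolding psd_collect_def Let_def psd_params.sel
    by (subst sum.swap) (intro sum.cong refl, simp add: psd_matrixD(2)[OF valid_paramsD(2)[OF assms]])
  fix v
  obtain g where
    "(\<Sum>p<psd_order (psd_collect P). \<Sum>q<psd_order (psd_collect P). v p * coeffs (psd_collect P) p q * v q) =
      (\<Sum>i<psd_order P. \<Sum>j<psd_order P. v (g i) * coeffs P i j * v (g j))"
    using psd_collect_form by blast
  then show "0 \<le> (\<Sum>p<psd_order (psd_collect P). \<Sum>q<psd_order (psd_collect P). v p * coeffs (psd_collect P) p q * v q)"
    using psd_matrixD(1)[OF valid_paramsD(2)[OF assms], of "\<lambda>i. v (g i)"] by simp
qed

section \<open>Marginalization, integration and rescaling\<close>

lemma valid_params_marginal:
  assumes "valid_params P" shows "valid_params (psd_marginal P)"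
  unfolding psd_marginal_def
  using valid_params_prodD[OF assms] valid_paramsD(2)[OF assms]
  by (intro valid_params_collect) (simp add: valid_params_def psd_matrix_cube_gram psd_order_def)

text \<open>The kernel on the product space factors, and for fixed \<open>x\<close> the
  \<open>x\<close>-factors are constants that join the coefficients; only kernel products in
  \<open>u\<close> remain to be integrated.\<close>

lemma psd_eval_marginal:
  assumes "valid_params P"
  shows "psd_eval (psd_marginal P) x = (LINT u:cube|lborel. psd_eval P (u, x))"
proof -
  let ?n = "psd_order P" and ?a = "\<lambda>i. fst (anchors P ! i)" and ?b = "\<lambda>i. snd (anchors P ! i)"
  let ?\<eta> = "fst (precision P)" and ?\<theta> = "snd (precision P)"
  have pair: "gkernel (precision P) (u, x) p = gkernel ?\<eta> u (fst p) * gkernel ?\<theta> x (snd p)" for u p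
    using gkernel_Pair[of ?\<eta> ?\<theta> u x "fst p" "snd p"] by simp
  have "psd_eval (psd_marginal P) x = (\<Sum>i<?n. \<Sum>j<?n.
    (coeffs P i j * gkernel ?\<theta> x (?b i) * gkernel ?\<theta> x (?b j)) * cube_gram ?\<eta> (?a i) (?a j))"
    unfolding psd_marginal_def psd_eval_collect psd_eval_PSD_Params
    by (intro sum.cong) (auto simp: psd_order_def mult_ac)
  also have "\<dots> = (LINT u:cube|lborel. \<Sum>i<?n. \<Sum>j<?n.
    (coeffs P i j * gkernel ?\<theta> x (?b i) * gkernel ?\<theta> x (?b j)) * gkernel ?\<eta> u (?a i) * gkernel ?\<eta> u (?a j))"
    by (rule cube_integral_form[symmetric]) (rule valid_params_prodD(1)[OF assms])
  also have "\<dots> = (LINT u:cube|lborel. psd_eval P (u, x))"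
    by (simp add: psd_eval_def pair mult_ac)
  finally show ?thesis .
qed

lemma psd_order_marginal_mult_fst_le: "psd_order (psd_marginal (psd_mult_fst P R)) \<le> psd_order R"
proof -
  let ?as = "map snd (anchors (psd_mult_fst P R))"
  have "psd_order (psd_marginal (psd_mult_fst P R)) = card (set ?as)"
    by (simp add: psd_marginal_def psd_collect_def Let_def length_remdups_card_conv)
  also have "\<dots> \<le> card (set (map snd (anchors R)))"
    \<comment> \<open>Only an inclusion is available in general: if \<open>P\<close> has no anchors,
      the product list is empty.\<close>
    by (rule card_mono) (auto simp: psd_mult_fst_def Let_def)
  also have "\<dots> \<le> psd_order R"
    using card_length[of "map snd (anchors R)"] by (simp add: psd_order_def)
  finally show ?thesis .
qed

lemma psd_integral_eq:
  assumes "valid_params P"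
  shows "psd_integral P = (LINT x:cube|lborel. psd_eval P x)"
  unfolding psd_integral_def psd_eval_def
  by (rule cube_integral_form[symmetric]) (rule valid_paramsD(1)[OF assms])

text \<open>The integral is the form of the Gram-weighted coefficients at the all-ones
  vector.\<close>

lemma psd_integral_nonneg:
  assumes "valid_params P" shows "0 \<le> psd_integral P"
  using psd_matrixD(1)[OF psd_matrix_cube_gram[OF valid_paramsD(2)[OF assms] valid_paramsD(1)[OF assms]],
      of "\<lambda>_. 1"]
  by (simp add: psd_integral_def)

lemma valid_params_scale:
  assumes "valid_params P" "0 \<le> c" shows "valid_params (psd_scale c P)"
  using valid_paramsD[OF assms(1)] psd_matrix_scale[OF _ assms(2)]
  by (simp add: valid_params_def psd_scale_def psd_order_def)

lemma psd_eval_scale: "psd_eval (psd_scale c P) x = c * psd_eval P x"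
  by (simp add: psd_eval_def psd_scale_def psd_order_def sum_distrib_left mult_ac)

subsection \<open>The filter\<close>

lemma represents_on_mult_fst:
  assumes "represents_on S P f" "represents_on (S \<times> T) R g"
  shows "represents_on (S \<times> T) (psd_mult_fst P R) (\<lambda>(u, x). f u * g (u, x))"
  using assms by (auto simp: represents_on_def valid_params_mult_fst psd_eval_mult_fst)

lemma represents_on_predict:
  assumes P: "represents_on cube P f" and R: "represents_on (cube \<times> cube) R q"
  shows "represents_on cube (psd_predict R P) (\<lambda>x. LINT u:cube|lborel. q (u, x) * f u)"
  unfolding represents_on_def psd_predict_def
proof (intro conjI ballI)
  have valid: "valid_params P" "valid_params R" using assms by (simp_all add: represents_on_def)
  then show "valid_params (psd_marginal (psd_mult_fst P R))"
    by (intro valid_params_marginal valid_params_mult_fst)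
  fix x :: 'a assume "x \<in> cube"
  then have "(LINT u:cube|lborel. q (u, x) * f u) = (LINT u:cube|lborel. psd_eval (psd_mult_fst P R) (u, x))"
    using assms by (intro set_lebesgue_integral_cong)
      (auto simp: represents_on_def psd_eval_mult_fst mult.commute)
  then show "(LINT u:cube|lborel. q (u, x) * f u) = psd_eval (psd_marginal (psd_mult_fst P R)) x"
    by (simp add: psd_eval_marginal valid_params_mult_fst valid)
qed

lemma represents_on_partial_eval:
  assumes "represents_on (S \<times> T) P f" "z \<in> T"
  shows "represents_on S (psd_partial_eval P z) (\<lambda>x. f (x, z))"
  using assms by (simp add: represents_on_def valid_params_partial_eval psd_eval_partial_eval)

lemma represents_on_mult:
  assumes "represents_on S P f" "represents_on S R g"
  shows "represents_on S (psd_mult P R) (\<lambda>x. f x * g x)"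
  using assms by (simp add: represents_on_def valid_params_mult psd_eval_mult)

text \<open>The likelihood does not depend on the integration variable and leaves the integral. This
  splits a filter step into prediction followed by multiplication with the evaluated
  likelihood.\<close>

lemma filter_op_eq: "filter_op q g z \<mu> = (\<lambda>x. (LINT u:cube|lborel. q (u, x) * \<mu> u) * g (x, z))"
proof
  fix x
  have "q (u, x) * g (x, z) * \<mu> u = g (x, z) * (q (u, x) * \<mu> u)" for u by simp
  then show "filter_op q g z \<mu> x = (LINT u:cube|lborel. q (u, x) * \<mu> u) * g (x, z)"
    unfolding filter_op_def by (simp only: set_integral_mult_right mult.commute)
qed

lemma represents_on_update:
  assumes "represents_on cube P f" "represents_on (cube \<times> cube) R q"
    and "represents_on (cube \<times> T) U g" "z \<in> T"
  shows "represents_on cube (psd_update R U z P) (filter_op q g z f)"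
  unfolding psd_update_def filter_op_eq
  by (intro represents_on_mult represents_on_predict assms(1,2)
      represents_on_partial_eval[OF assms(3,4)])

lemma psd_integral_represents:
  assumes "represents_on cube P f"
  shows "psd_integral P = (LINT x:cube|lborel. f x)"
  using assms by (subst psd_integral_eq) (auto simp: represents_on_def intro!: set_lebesgue_integral_cong)

lemma represents_on_scale:
  assumes "represents_on S P f" "0 \<le> c"
  shows "represents_on S (psd_scale c P) (\<lambda>x. c * f x)"
  using assms by (simp add: represents_on_def valid_params_scale psd_eval_scale)

lemma represents_on_cong:
  assumes "\<And>x. x \<in> S \<Longrightarrow> f x = g x"
  shows "represents_on S P f \<longleftrightarrow> represents_on S P g"
  using assms by (simp add: represents_on_def)

lemma psd_order_update_le: "psd_order (psd_update R U z P) \<le> psd_order R * psd_order U"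
proof -
  have "psd_order (psd_partial_eval U z) = psd_order U"
    by (simp add: psd_partial_eval_def Let_def psd_order_def)
  then show ?thesis
    by (simp add: psd_update_def psd_predict_def mult_le_mono1 psd_order_marginal_mult_fst_le)
qed

text \<open>No induction on \<open>k\<close>: the bound for one update is uniform in the preceding
  parameters, and rescaling keeps the anchors.\<close>

lemma psd_order_filter_Suc_le:
  "psd_order (psd_filter P R U z (Suc k)) \<le> psd_order R * psd_order U"
  using psd_order_update_le[of R U "z (Suc k)" "psd_filter P R U z k"]
  by (simp add: Let_def psd_scale_def psd_order_def)

text \<open>Being computed by the algorithm is rendered operation by operation: each intermediate
  parameter set represents its function exactly, and \<open>psd_integral\<close> returns the
  normalizing constant.\<close>

theorem corollary1:
  fixes \<pi> :: "nat \<Rightarrow> real ^ 'd \<Rightarrow> real"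
    and Q :: "(real ^ 'd) \<times> (real ^ 'd) \<Rightarrow> real"
    and G :: "(real ^ 'd) \<times> (real ^ 'e) \<Rightarrow> real"
    and z :: "nat \<Rightarrow> real ^ 'e"
    and P\<^sub>0 :: "(real ^ 'd) psd_params"
    and P\<^sub>Q :: "((real ^ 'd) \<times> (real ^ 'd)) psd_params"
    and P\<^sub>G :: "((real ^ 'd) \<times> (real ^ 'e)) psd_params"
    and M\<^sub>0 M\<^sub>Q M\<^sub>G :: nat
  assumes "represents_on cube P\<^sub>0 (\<pi> 0)" and "psd_order P\<^sub>0 = M\<^sub>0"
    and "represents_on (cube \<times> cube) P\<^sub>Q Q" and "psd_order P\<^sub>Q = M\<^sub>Q"
    and "represents_on (cube \<times> cube) P\<^sub>G G" and "psd_order P\<^sub>G = M\<^sub>G"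
    and "\<And>n. n \<ge> 1 \<Longrightarrow> z n \<in> cube"
    and "\<And>n. n \<ge> 1 \<Longrightarrow> filter_mass Q G (z n) (\<pi> (n - 1)) \<noteq> 0"
    and "\<And>n x. n \<ge> 1 \<Longrightarrow> x \<in> cube \<Longrightarrow>
           \<pi> n x = filter_op Q G (z n) (\<pi> (n - 1)) x / filter_mass Q G (z n) (\<pi> (n - 1))"
  shows "\<forall>n\<ge>1.
    (\<exists>M \<le> M\<^sub>Q * M\<^sub>G. gaussian_psd_model_on cube M (\<pi> n)) \<and>
    psd_order (psd_filter P\<^sub>0 P\<^sub>Q P\<^sub>G z n) \<le> M\<^sub>Q * M\<^sub>G \<and>
    represents_on cube (psd_filter P\<^sub>0 P\<^sub>Q P\<^sub>G z n) (\<pi> n) \<and>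
    (let P = psd_filter P\<^sub>0 P\<^sub>Q P\<^sub>G z (n - 1);
         T = psd_update P\<^sub>Q P\<^sub>G (z n) P
     in represents_on (cube \<times> cube) (psd_mult_fst P P\<^sub>Q) (\<lambda>(u, x). \<pi> (n - 1) u * Q (u, x)) \<and>
        represents_on cube (psd_predict P\<^sub>Q P) (\<lambda>x. LINT u:cube|lborel. Q (u, x) * \<pi> (n - 1) u) \<and>
        represents_on cube (psd_partial_eval P\<^sub>G (z n)) (\<lambda>x. G (x, z n)) \<and>
        represents_on cube T (filter_op Q G (z n) (\<pi> (n - 1))) \<and>
        psd_integral T = filter_mass Q G (z n) (\<pi> (n - 1)))"
proof -
  have z: "z (Suc k) \<in> cube" for k using assms(7) by simp
  \<comment> \<open>Stated for any \<open>P\<close> representing \<open>\<pi> k\<close>, so that it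
    serves both the induction step and the final conjunct.\<close>
  have mass: "psd_integral (psd_update P\<^sub>Q P\<^sub>G (z (Suc k)) P) = filter_mass Q G (z (Suc k)) (\<pi> k)"
    if "represents_on cube P (\<pi> k)" for k P
    unfolding filter_mass_def
    by (rule psd_integral_represents[OF represents_on_update[OF that assms(3,5) z]])
  have step: "represents_on cube (psd_filter P\<^sub>0 P\<^sub>Q P\<^sub>G z (Suc k)) (\<pi> (Suc k))"
    if "represents_on cube (psd_filter P\<^sub>0 P\<^sub>Q P\<^sub>G z k) (\<pi> k)" for k
  proof -
    define T where "T = psd_update P\<^sub>Q P\<^sub>G (z (Suc k)) (psd_filter P\<^sub>0 P\<^sub>Q P\<^sub>G z k)"
    have T: "represents_on cube T (filter_op Q G (z (Suc k)) (\<pi> k))"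
      unfolding T_def by (rule represents_on_update[OF that assms(3,5) z])
    then have "0 \<le> 1 / psd_integral T"
      by (simp add: psd_integral_nonneg represents_on_def)
    note scaled = represents_on_scale[OF T this]
    \<comment> \<open>The recursion prescribes values on the cube only, which is all that
      \<open>represents_on_cong\<close> compares.\<close>
    have "\<pi> (Suc k) x = 1 / psd_integral T * filter_op Q G (z (Suc k)) (\<pi> k) x" if "x \<in> cube" for x
      using assms(9)[of "Suc k" x] that mass[OF \<open>represents_on cube (psd_filter P\<^sub>0 P\<^sub>Q P\<^sub>G z k) (\<pi> k)\<close>]
      by (simp add: T_def)
    from iffD2[OF represents_on_cong[OF this] scaled] show ?thesis
      by (simp add: T_def Let_def)
  qed
  have filter: "represents_on cube (psd_filter P\<^sub>0 P\<^sub>Q P\<^sub>G z k) (\<pi> k)" for k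
    by (induction k) (simp add: assms(1), rule step)
  show ?thesis
  proof (intro allI impI)
    fix n :: nat assume "1 \<le> n"
    then obtain k where n: "n = Suc k" by (cases n) auto
    have order: "psd_order (psd_filter P\<^sub>0 P\<^sub>Q P\<^sub>G z n) \<le> M\<^sub>Q * M\<^sub>G"
      using psd_order_filter_Suc_le[of P\<^sub>0 P\<^sub>Q P\<^sub>G z k] assms(4,6) by (simp only: n)
    then have "\<exists>M \<le> M\<^sub>Q * M\<^sub>G. gaussian_psd_model_on cube M (\<pi> n)"
      unfolding gaussian_psd_model_on_def using filter[of n] by blast
    with order filter[of n] show "(\<exists>M \<le> M\<^sub>Q * M\<^sub>G. gaussian_psd_model_on cube M (\<pi> n)) \<and>
      psd_order (psd_filter P\<^sub>0 P\<^sub>Q P\<^sub>G z n) \<le> M\<^sub>Q * M\<^sub>G \<and>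
      represents_on cube (psd_filter P\<^sub>0 P\<^sub>Q P\<^sub>G z n) (\<pi> n) \<and>
      (let P = psd_filter P\<^sub>0 P\<^sub>Q P\<^sub>G z (n - 1);
           T = psd_update P\<^sub>Q P\<^sub>G (z n) P
       in represents_on (cube \<times> cube) (psd_mult_fst P P\<^sub>Q) (\<lambda>(u, x). \<pi> (n - 1) u * Q (u, x)) \<and>
          represents_on cube (psd_predict P\<^sub>Q P) (\<lambda>x. LINT u:cube|lborel. Q (u, x) * \<pi> (n - 1) u) \<and>
          represents_on cube (psd_partial_eval P\<^sub>G (z n)) (\<lambda>x. G (x, z n)) \<and>
          represents_on cube T (filter_op Q G (z n) (\<pi> (n - 1))) \<and>
          psd_integral T = filter_mass Q G (z n) (\<pi> (n - 1)))"
      unfolding n Let_def diff_Suc_1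
      by (intro conjI represents_on_mult_fst represents_on_predict represents_on_update[OF _ _ assms(5)] mass
          represents_on_partial_eval[OF assms(5)] filter z assms(3,5))
  qed
qed

end
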